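(* Fix $\alpha\in[0,1)$, and let $f=h+\overline{g}$ be a harmonic mapping in $\mathbb{D}$, where $h$ and $g$ are analytic in $\mathbb{D}$, and let $\omega=g'/h'$. (I) If $h-g$ (or $h+g$) is $\alpha$-close-to-convex and $|\omega(z)|\leq M_1$ for $z\in\mathbb{D}$, where $M_1$ is a constant with $$M_1<\frac{\cos\frac{\alpha\pi}{2}}{1+\cos\frac{\alpha\pi}{2}},$$ then $h$ is univalent and $h(\mathbb{D})$ is an $M_2$-linearly connected domain, where $$M_2=\frac{1}{\cos\frac{\alpha\pi}{2}-M_1\left(1+\cos\frac{\alpha\pi}{2}\right)}.$$ (II) If $h-g$ (or $h+g$) is $\alpha$-close-to-convex and $|\omega(z)|\leq M_3$ for $z\in\mathbb{D}$, where $M_3$ is a constant with $$M_3<\frac{\cos\frac{\alpha\pi}{2}}{2+\cos\frac{\alpha\pi}{2}},$$ then for every $\theta\in[0,2\pi)$ the function $f_\theta=h+e^{i\theta}\overline{g}$ is a $K$-quasiconformal harmonic mapping and $f_\theta(\mathbb{D})$ is an $M_4$-linearly connected domain, where $$K=\frac{1+M_3}{1-M_3},\qquad M_4=\frac{1+M_3}{\cos\frac{\alpha\pi}{2}-M_3\left(2+\cos\frac{\alpha\pi}{2}\right)}.$$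
   Context: $\mathbb{D}$ is the open unit disk. A harmonic mapping is a complex-valued harmonic function; univalent means injective; $\omega=g'/h'$ is the (second) complex dilatation of $f$. For $\alpha\in[0,1)$, a univalent analytic function $F$ in $\mathbb{D}$ is called $\alpha$-close-to-convex if there is a univalent and convex analytic function $\phi$ in $\mathbb{D}$ (i.e. $\phi$ is injective and $\phi(\mathbb{D})$ is convex) such that $\left|\arg[F'(z)/\phi'(z)]\right|\leq\frac{\alpha\pi}{2}$ for all $z\in\mathbb{D}$. A domain $\Omega\subset\mathbb{C}$ is $M$-linearly connected, where $M\in[1,\infty)$, if any two points $z,w\in\Omega$ can be joined by a path $\gamma\subset\Omega$ of length $\ell(\gamma)\leq M|z-w|$. A $K$-quasiconformal harmonic mapping $F$ on $\mathbb{D}$ is a univalent sense-preserving harmonic mapping with $\Lambda_F(z)\leq K\lambda_F(z)$ for all $z\in\mathbb{D}$, where $\Lambda_F=|F_z|+|F_{\overline z}|$ and $\lambda_F=\big||F_z|-|F_{\overline z}|\big|$. *)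

theory Defs
  imports "HOL-Complex_Analysis.Complex_Analysis"
begin

abbreviation unit_disk :: "complex set"  ("\<D>")
  where "\<D> \<equiv> ball 0 1"


section \<open>Harmonic mappings\<close>

definition dx :: "(complex \<Rightarrow> complex) \<Rightarrow> complex \<Rightarrow> complex" where
  "dx F z = vector_derivative (\<lambda>t::real. F (z + of_real t)) (at 0)"

definition dy :: "(complex \<Rightarrow> complex) \<Rightarrow> complex \<Rightarrow> complex" where
  "dy F z = vector_derivative (\<lambda>t::real. F (z + \<i> * of_real t)) (at 0)"

text \<open>
  \<open>C\<^sup>2\<close> with vanishing Laplacian. Since \<^const>\<open>vector_derivative\<close> is total, the existence of the
  partial derivatives has to be demanded; it is provided by (real) differentiability of the
  function and of its first partial derivatives.
\<close>
definition harmonic_on :: "(complex \<Rightarrow> complex) \<Rightarrow> complex set \<Rightarrow> bool" where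
  "harmonic_on F S \<longleftrightarrow>
     open S \<and>
     F differentiable_on S \<and> dx F differentiable_on S \<and> dy F differentiable_on S \<and>
     continuous_on S (dx (dx F)) \<and> continuous_on S (dx (dy F)) \<and>
     continuous_on S (dy (dx F)) \<and> continuous_on S (dy (dy F)) \<and>
     (\<forall>z\<in>S. dx (dx F) z + dy (dy F) z = 0)"

definition wirtinger :: "(complex \<Rightarrow> complex) \<Rightarrow> complex \<Rightarrow> complex" where
  "wirtinger F z = (dx F z - \<i> * dy F z) / 2"

definition wirtinger_bar :: "(complex \<Rightarrow> complex) \<Rightarrow> complex \<Rightarrow> complex" where
  "wirtinger_bar F z = (dx F z + \<i> * dy F z) / 2"

definition max_stretch :: "(complex \<Rightarrow> complex) \<Rightarrow> complex \<Rightarrow> real" where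
  "max_stretch F z = cmod (wirtinger F z) + cmod (wirtinger_bar F z)"

definition min_stretch :: "(complex \<Rightarrow> complex) \<Rightarrow> complex \<Rightarrow> real" where
  "min_stretch F z = \<bar>cmod (wirtinger F z) - cmod (wirtinger_bar F z)\<bar>"

text \<open>
  \<open>\<bar>F\<^sub>z\<bar>\<^sup>2 - \<bar>F\<^sub>z\<^sub>b\<^sub>a\<^sub>r\<bar>\<^sup>2\<close> is the Jacobian determinant of \<open>F\<close>.
\<close>
definition sense_preserving_on :: "(complex \<Rightarrow> complex) \<Rightarrow> complex set \<Rightarrow> bool" where
  "sense_preserving_on F S \<longleftrightarrow>
     (\<forall>z\<in>S. (cmod (wirtinger F z))\<^sup>2 - (cmod (wirtinger_bar F z))\<^sup>2 > 0)"

definition quasiconformal_harmonic :: "real \<Rightarrow> (complex \<Rightarrow> complex) \<Rightarrow> bool" where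
  "quasiconformal_harmonic K F \<longleftrightarrow>
     harmonic_on F \<D> \<and> inj_on F \<D> \<and> sense_preserving_on F \<D> \<and>
     (\<forall>z\<in>\<D>. max_stretch F z \<le> K * min_stretch F z)"


section \<open>Close-to-convex functions\<close>

text \<open>
  Both derivatives are automatically nonzero on the disk by univalence, so the junk values
  of \<^const>\<open>Arg\<close> and of division at \<open>0\<close> play no role.
\<close>
definition close_to_convex :: "real \<Rightarrow> (complex \<Rightarrow> complex) \<Rightarrow> bool" where
  "close_to_convex \<alpha> F \<longleftrightarrow>
     F holomorphic_on \<D> \<and> inj_on F \<D> \<and>
     (\<exists>\<phi>. \<phi> holomorphic_on \<D> \<and> inj_on \<phi> \<D> \<and> convex (\<phi> ` \<D>) \<and>
          (\<forall>z\<in>\<D>. \<bar>Arg (deriv F z / deriv \<phi> z)\<bar> \<le> \<alpha> * pi / 2))"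


section \<open>Linearly connected domains\<close>

text \<open>
  The length of a path is the supremum of the lengths of its inscribed polygons; it is
  infinite for non-rectifiable paths.
\<close>
definition curve_length :: "(real \<Rightarrow> complex) \<Rightarrow> ennreal" where
  "curve_length \<gamma> =
     (SUP ts \<in> {ts. sorted ts \<and> set ts \<subseteq> {0..1}}.
        \<Sum>i<length ts - 1. ennreal (dist (\<gamma> (ts ! i)) (\<gamma> (ts ! Suc i))))"

definition linearly_connected_domain :: "real \<Rightarrow> complex set \<Rightarrow> bool" where
  "linearly_connected_domain M \<Omega> \<longleftrightarrow>
     1 \<le> M \<and> open \<Omega> \<and> connected \<Omega> \<and> \<Omega> \<noteq> {} \<and>
     (\<forall>z\<in>\<Omega>. \<forall>w\<in>\<Omega>. \<exists>\<gamma>. path \<gamma> \<and> path_image \<gamma> \<subseteq> \<Omega> \<and>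
        pathstart \<gamma> = z \<and> pathfinish \<gamma> = w \<and>
        curve_length \<gamma> \<le> ennreal (M * cmod (z - w)))"

end

theory Submission
  imports Defs
begin

text \<open>
  The disk is the wrong domain to look at. Let \<open>F = h \<plusminus> g\<close> be the close-to-convex function and
  \<open>\<phi>\<close> the convex function it is compared with. After the change of variable \<open>\<zeta> = \<phi> z\<close> the domain
  \<open>\<Omega> = \<phi>(\<D>)\<close> is convex, and \<open>\<psi> = \<phi>\<inverse>\<close> turns the bound on \<open>arg (F'/\<phi>')\<close> into
  \<open>Re u' \<ge> c \<bar>u'\<bar>\<close> for \<open>u = F \<circ> \<psi>\<close>, with \<open>c = cos (\<alpha>\<pi>/2)\<close>. So, along any segment of \<open>\<Omega>\<close>, the
  velocity of \<open>u\<close> makes a bounded acute angle with the direction of the segment. A small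
  dilatation makes \<open>g\<close> a small perturbation of \<open>F\<close>, so \<open>h\<close> and \<open>h + e\<^sup>i\<^sup>\<theta> cnj g\<close> keep this
  property with a worse constant. Both are of the form \<open>h + \<mu> cnj g\<close>, with \<open>\<mu> = 0\<close> for the
  first part and \<open>\<bar>\<mu>\<bar> = 1\<close> for the second. With \<open>M\<close> the bound on the dilatation, the pointwise
  estimate \<open>directed_affine_bound\<close> says that the velocity \<open>v\<close> of \<open>(h + \<mu> cnj g) \<circ> \<psi>\<close> in
  direction \<open>d\<close> satisfies
  \<open>v \<bullet> d \<ge> k \<bar>v\<bar> \<bar>d\<bar>\<close> where \<open>k = (c - M (1 + \<bar>\<mu>\<bar> + c)) / (1 + \<bar>\<mu>\<bar> M)\<close>;
  the two constants of the theorem are the values of \<open>1/k\<close>.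

  Such a map is injective, because the component of its value in direction \<open>d\<close> strictly
  increases along a segment in direction \<open>d\<close>. The image of the segment has length at most
  \<open>1/k\<close> times the increase of that component, hence at most \<open>1/k\<close> times the distance of its end points. This is
  \<open>directed_map_on_convex\<close>, a quantitative form of the Noshiro--Warschawski argument. It settles
  univalence and linear connectedness; quasiconformality is then the bound on the dilatation,
  read off from the Wirtinger derivatives \<open>h'\<close> and \<open>\<mu> cnj g'\<close>.
\<close>

section \<open>Maps that advance along segments of a convex domain\<close>

text \<open>
  Domination of the chords of \<open>\<gamma>\<close> by the increments of a real function \<open>q\<close> bounds the length
  without any integral: the sum over an inscribed polygon telescopes.
\<close>

lemma curve_length_le_increment:
  assumes incr: "\<And>s t. 0 \<le> s \<Longrightarrow> s \<le> t \<Longrightarrow> t \<le> 1 \<Longrightarrow> dist (\<gamma> s) (\<gamma> t) \<le> q t - q s"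
  shows "curve_length \<gamma> \<le> ennreal (q 1 - q 0)"
  unfolding curve_length_def
proof (rule SUP_least)
  fix ts :: "real list"
  assume "ts \<in> {ts. sorted ts \<and> set ts \<subseteq> {0..1}}"
  then have ts: "sorted ts" "set ts \<subseteq> {0..1}" by auto
  define n where "n = length ts - 1"
  have mem: "0 \<le> ts ! i" "ts ! i \<le> 1" if "i < length ts" for i
    using ts(2) nth_mem[OF that] by auto
  have "(\<Sum>i<n. dist (\<gamma> (ts ! i)) (\<gamma> (ts ! Suc i))) \<le> (\<Sum>i<n. q (ts ! Suc i) - q (ts ! i))"
    by (intro sum_mono incr mem sorted_nth_mono[OF ts(1)]) (auto simp: n_def)
  also have "\<dots> = q (ts ! n) - q (ts ! 0)"
    by (rule sum_lessThan_telescope)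
  finally have le: "(\<Sum>i<n. dist (\<gamma> (ts ! i)) (\<gamma> (ts ! Suc i))) \<le> q (ts ! n) - q (ts ! 0)" .
  have mono: "q s \<le> q t" if "0 \<le> s" "s \<le> t" "t \<le> 1" for s t
    using incr[OF that] zero_le_dist[of "\<gamma> s" "\<gamma> t"] by linarith
  have "(\<Sum>i<n. dist (\<gamma> (ts ! i)) (\<gamma> (ts ! Suc i))) \<le> q 1 - q 0"
  proof (cases "ts = []")
    case True
    then show ?thesis using mono[of 0 1] by (simp add: n_def)
  next
    case False
    then have "q (ts ! n) \<le> q 1" "q 0 \<le> q (ts ! 0)"
      using mem[of n] mem[of 0] by (auto intro!: mono simp: n_def)
    then show ?thesis using le by linarith
  qed
  then show "(\<Sum>i<length ts - 1. ennreal (dist (\<gamma> (ts ! i)) (\<gamma> (ts ! Suc i)))) \<le> ennreal (q 1 - q 0)"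
    by (simp add: n_def sum_ennreal ennreal_leI)
qed

text \<open>
  The hypothesis \<open>dir\<close> says that the derivative of \<open>T\<close> turns every direction \<open>d\<close> by an angle whose cosine is at
  least \<open>k\<close>. Along the segment from \<open>a\<close> to \<open>b\<close>, with \<open>d = b - a\<close>, the speed of \<open>T\<close> is then at
  most the derivative of \<open>q = (T \<bullet> d) / (k \<bar>d\<bar>)\<close>. So \<open>q\<close> controls the length of the image curve,
  and its total increase is at most \<open>\<bar>T b - T a\<bar> / k\<close> by Cauchy--Schwarz.
\<close>
lemma directed_map_on_convex:
  fixes T :: "complex \<Rightarrow> complex"
  assumes \<Omega>: "open \<Omega>" "convex \<Omega>" "\<Omega> \<noteq> {}" and "0 < k"
    and der: "\<And>z. z \<in> \<Omega> \<Longrightarrow> (T has_derivative T' z) (at z)"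
    and nz: "\<And>z d. z \<in> \<Omega> \<Longrightarrow> d \<noteq> 0 \<Longrightarrow> T' z d \<noteq> 0"
    and dir: "\<And>z d. z \<in> \<Omega> \<Longrightarrow> k * (norm (T' z d) * norm d) \<le> T' z d \<bullet> d"
  shows "inj_on T \<Omega>" "linearly_connected_domain (1 / k) (T ` \<Omega>)"
proof -
  define \<gamma> where "\<gamma> a d t = T (a + of_real t * d)" for a d :: complex and t :: real
  define q where "q a d t = (\<gamma> a d t \<bullet> d) / (k * norm d)" for a d :: complex and t :: real
  have seg: "a + of_real t * (b - a) \<in> \<Omega>" if "a \<in> \<Omega>" "b \<in> \<Omega>" "0 \<le> t" "t \<le> 1" for a b t
    using convexD_alt[OF \<Omega>(2) that(1,2,3,4)] by (simp add: algebra_simps scaleR_conv_of_real)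
  have d\<gamma>: "(\<gamma> a d has_vector_derivative T' (a + of_real t * d) d) (at t)"
    if "a + of_real t * d \<in> \<Omega>" for a d t
  proof -
    have "((\<lambda>t. a + of_real t * d) has_vector_derivative d) (at t)"
      by (auto intro!: derivative_eq_intros)
    then have "((\<lambda>t. a + of_real t * d) has_derivative (\<lambda>s. s *\<^sub>R d)) (at t)"
      by (simp add: has_vector_derivative_def)
    from has_derivative_compose[OF this der[OF that]]
    show ?thesis
      using linear_scale[OF has_derivative_linear[OF der[OF that]]]
      by (simp add: \<gamma>_def[abs_def] has_vector_derivative_def o_def)
  qed
  have dq: "(q a d has_vector_derivative (T' (a + of_real t * d) d \<bullet> d) / (k * norm d)) (at t)"
    if "a + of_real t * d \<in> \<Omega>" for a d t
    unfolding q_def[abs_def]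
    by (intro bounded_linear.has_vector_derivative[OF bounded_linear_divide]
        bounded_linear.has_vector_derivative[OF bounded_linear_inner_left] d\<gamma>[OF that])
  have cont: "continuous_on {s..t} (\<gamma> a (b - a))" "continuous_on {s..t} (q a (b - a))"
    if "a \<in> \<Omega>" "b \<in> \<Omega>" "0 \<le> s" "t \<le> 1" for a b s t
    using seg[OF that(1,2)] that(3,4)
    by (intro continuous_at_imp_continuous_on ballI has_vector_derivative_continuous[OF d\<gamma>]
        has_vector_derivative_continuous[OF dq]; simp)+
  have incr: "dist (\<gamma> a (b - a) s) (\<gamma> a (b - a) t) \<le> q a (b - a) t - q a (b - a) s"
    if "a \<in> \<Omega>" "b \<in> \<Omega>" "0 \<le> s" "s \<le> t" "t \<le> 1" for a b s t
  proof (cases "s = t \<or> a = b")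
    case True
    then show ?thesis by (auto simp: \<gamma>_def q_def)
  next
    case False
    have "norm (\<gamma> a (b - a) t - \<gamma> a (b - a) s) \<le> q a (b - a) t - q a (b - a) s"
    proof (rule differentiable_bound_general)
      fix x assume x: "s < x" "x < t"
      have xO: "a + of_real x * (b - a) \<in> \<Omega>"
        using seg that x by force
      show "(\<gamma> a (b - a) has_vector_derivative T' (a + of_real x * (b - a)) (b - a)) (at x)"
        by (rule d\<gamma>[OF xO])
      show "(q a (b - a) has_vector_derivative
          (T' (a + of_real x * (b - a)) (b - a) \<bullet> (b - a)) / (k * norm (b - a))) (at x)"
        by (rule dq[OF xO])
      show "norm (T' (a + of_real x * (b - a)) (b - a)) \<le>
          (T' (a + of_real x * (b - a)) (b - a) \<bullet> (b - a)) / (k * norm (b - a))"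
      proof -
        have "b \<noteq> a" using False by blast
        then have "0 < k * norm (b - a)" using \<open>0 < k\<close> by simp
        then show ?thesis
          using dir[OF xO, of "b - a"] by (simp only: pos_le_divide_eq ac_simps)
      qed
    qed (use False that cont in auto)
    then show ?thesis by (simp add: dist_norm norm_minus_commute)
  qed
  have pos: "0 < T' z d \<bullet> d" if "z \<in> \<Omega>" "d \<noteq> 0" for z d
    using dir[OF that(1), of d] nz[OF that] that \<open>0 < k\<close>
    by (smt (verit) mult_pos_pos zero_less_norm_iff)
  show inj: "inj_on T \<Omega>"
  proof (rule inj_onI, rule ccontr)
    fix a b assume ab: "a \<in> \<Omega>" "b \<in> \<Omega>" "T a = T b" "a \<noteq> b"
    have "q a (b - a) 0 < q a (b - a) 1"
    proof (rule DERIV_pos_imp_increasing_open[of 0 1 "q a (b - a)"])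
      fix x :: real assume "0 < x" "x < 1"
      then have "a + of_real x * (b - a) \<in> \<Omega>" using seg ab by force
      then show "\<exists>y. (q a (b - a) has_real_derivative y) (at x) \<and> 0 < y"
        using dq[of a x "b - a"] pos[of "a + of_real x * (b - a)" "b - a"] ab \<open>0 < k\<close>
        by (metis has_real_derivative_iff_has_vector_derivative divide_pos_pos mult_pos_pos
            right_minus_eq zero_less_norm_iff)
    qed (use cont ab in auto)
    then show False using ab by (simp add: q_def \<gamma>_def)
  qed
  have contT: "continuous_on \<Omega> T"
    using der by (meson continuous_at_imp_continuous_on has_derivative_continuous)
  obtain z0 where z0: "z0 \<in> \<Omega>" using \<Omega> by auto
  \<comment> \<open>Cauchy--Schwarz in a single direction; linear connectedness asks for a constant 1 / k that is at least 1.\<close>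
  have "k \<le> 1"
  proof -
    have "T' z0 1 \<bullet> 1 \<le> norm (T' z0 1)" using norm_cauchy_schwarz[of "T' z0 1" 1] by simp
    then have "k * norm (T' z0 1) \<le> 1 * norm (T' z0 1)" using dir[OF z0, of 1] by simp
    then show ?thesis using nz[OF z0, of 1] by simp
  qed
  show "linearly_connected_domain (1 / k) (T ` \<Omega>)"
    unfolding linearly_connected_domain_def
  proof (intro conjI ballI)
    show "1 \<le> 1 / k" using \<open>0 < k\<close> \<open>k \<le> 1\<close> by simp
    show "open (T ` \<Omega>)" by (rule invariance_of_domain[OF contT \<Omega>(1) inj])
    show "connected (T ` \<Omega>)" by (intro connected_continuous_image contT convex_connected \<Omega>)
    show "T ` \<Omega> \<noteq> {}" using \<Omega> by auto
    fix z w assume "z \<in> T ` \<Omega>" "w \<in> T ` \<Omega>"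
    then obtain a b where ab: "a \<in> \<Omega>" "b \<in> \<Omega>" "z = T a" "w = T b" by auto
    have "curve_length (\<gamma> a (b - a)) \<le> ennreal (q a (b - a) 1 - q a (b - a) 0)"
      by (rule curve_length_le_increment) (use incr ab in auto)
    also have "q a (b - a) 1 - q a (b - a) 0 = ((w - z) \<bullet> (b - a)) / (k * norm (b - a))"
      by (simp add: q_def \<gamma>_def ab inner_diff_left diff_divide_distrib)
    also have "\<dots> \<le> 1 / k * norm (z - w)"
      using norm_cauchy_schwarz[of "w - z" "b - a"] \<open>0 < k\<close>
      by (cases "a = b") (simp_all add: field_simps norm_minus_commute)
    finally have "curve_length (\<gamma> a (b - a)) \<le> ennreal (1 / k * norm (z - w))"
      by (simp add: ennreal_leI)
    moreover have "path (\<gamma> a (b - a))" "path_image (\<gamma> a (b - a)) \<subseteq> T ` \<Omega>"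
      "pathstart (\<gamma> a (b - a)) = z" "pathfinish (\<gamma> a (b - a)) = w"
      using cont[OF ab(1,2)] seg[OF ab(1,2)]
      by (auto simp: path_def path_image_def pathstart_def pathfinish_def \<gamma>_def ab(3,4))
    ultimately show "\<exists>\<gamma>. path \<gamma> \<and> path_image \<gamma> \<subseteq> T ` \<Omega> \<and> pathstart \<gamma> = z \<and> pathfinish \<gamma> = w \<and>
        curve_length \<gamma> \<le> ennreal (1 / k * norm (z - w))"
      by blast
  qed
qed

section \<open>The pointwise estimate\<close>

lemma cos_mult_cmod_le_Re:
  assumes "\<bar>Arg u\<bar> \<le> \<beta>" "\<beta> \<le> pi"
  shows "cos \<beta> * cmod u \<le> Re u"
proof (cases "u = 0")
  case False
  have "cos \<beta> \<le> cos \<bar>Arg u\<bar>"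
    using assms by (intro cos_monotone_0_pi_le) auto
  also have "\<dots> = Re u / cmod u"
    using False by (simp add: cos_Arg)
  finally show ?thesis using False by (simp add: field_simps)
qed auto

text \<open>
  Here \<open>a\<close>, \<open>b\<close>, \<open>u\<close> stand for the derivatives of \<open>h\<close>, \<open>g\<close> and \<open>h \<plusminus> g\<close>. Passing from \<open>u\<close> to \<open>a\<close>
  costs \<open>(1 + c) \<bar>b\<bar>\<close> in the real part, and the anti-linear term costs another \<open>\<bar>\<mu>\<bar> \<bar>b\<bar>\<close>; since
  \<open>\<bar>b\<bar> \<le> M \<bar>a\<bar>\<close>, what is left is \<open>(c - M (1 + \<bar>\<mu>\<bar> + c)) \<bar>a\<bar>\<close>, to be compared with the
  stretching \<open>(1 + \<bar>\<mu>\<bar> M) \<bar>a\<bar>\<close>.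
\<close>
lemma directed_affine_bound:
  fixes a b u \<mu> d :: complex
  assumes "norm b \<le> M * norm a" "c * norm u \<le> Re u" "u = a + b \<or> u = a - b" "0 \<le> c"
    and "0 \<le> M" "k * (1 + norm \<mu> * M) = c - M * (1 + norm \<mu> + c)" "0 \<le> k"
  shows "k * (norm (a * d + \<mu> * cnj (b * d)) * norm d) \<le> (a * d + \<mu> * cnj (b * d)) \<bullet> d"
proof -
  let ?r = "norm \<mu>"
  have "norm (a * d + \<mu> * cnj (b * d)) \<le> (norm a + ?r * norm b) * norm d"
    by (rule order_trans[OF norm_triangle_ineq]) (simp add: norm_mult algebra_simps)
  also have "\<dots> \<le> (1 + ?r * M) * norm a * norm d"
    using mult_left_mono[OF assms(1), of ?r] by (intro mult_right_mono) (auto simp: algebra_simps)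
  finally have "k * (norm (a * d + \<mu> * cnj (b * d)) * norm d) \<le>
      k * (((1 + ?r * M) * norm a * norm d) * norm d)"
    using assms by (intro mult_left_mono mult_right_mono) auto
  also have "\<dots> = (k * (1 + ?r * M)) * norm a * (norm d)\<^sup>2"
    by (simp add: power2_eq_square)
  also have "\<dots> = (c - M * (1 + ?r + c)) * norm a * (norm d)\<^sup>2"
    using assms by simp
  also have "\<dots> \<le> (Re a - ?r * norm b) * (norm d)\<^sup>2"
  proof (rule mult_right_mono)
    have "norm a \<le> norm u + norm b" "Re u \<le> Re a + norm b"
      using assms(3) norm_triangle_ineq4[of "a + b" b] norm_triangle_ineq[of "a - b" b]
        abs_Re_le_cmod[of b] by auto
    then have "c * norm a - c * norm b \<le> Re a + norm b"
      using mult_left_mono[of "norm a" "norm u + norm b" c] assms by (simp add: algebra_simps)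
    moreover have "(1 + ?r + c) * norm b \<le> (1 + ?r + c) * (M * norm a)"
      using assms by (intro mult_left_mono) auto
    ultimately show "(c - M * (1 + ?r + c)) * norm a \<le> Re a - ?r * norm b"
      by (simp add: algebra_simps)
  qed auto
  also have "\<dots> \<le> (a * d + \<mu> * cnj (b * d)) \<bullet> d"
  proof -
    have eq: "(a * d + \<mu> * cnj (b * d)) \<bullet> d = Re a * (norm d)\<^sup>2 + Re (\<mu> * cnj b * (cnj d * cnj d))"
      unfolding cmod_power2 inner_complex_def by (simp add: algebra_simps power2_eq_square)
    have "- Re (\<mu> * cnj b * (cnj d * cnj d)) \<le> norm (\<mu> * cnj b * (cnj d * cnj d))"
      using abs_Re_le_cmod[of "\<mu> * cnj b * (cnj d * cnj d)"] by linarith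
    then show ?thesis unfolding eq by (simp add: norm_mult power2_eq_square algebra_simps)
  qed
  finally show ?thesis .
qed


section \<open>Derivatives of \<open>H + \<mu> cnj G\<close>\<close>

lemma has_derivative_holomorphic_plus_cnj:
  assumes "(H has_field_derivative a) (at z)" "(G has_field_derivative b) (at z)"
  shows "((\<lambda>z. H z + \<mu> * cnj (G z)) has_derivative (\<lambda>d. a * d + \<mu> * cnj (b * d))) (at z)"
  using assms unfolding has_field_derivative_def
  by (auto intro!: derivative_eq_intros has_derivative_cnj simp: fun_eq_iff)

lemma has_vector_derivative_holomorphic_plus_cnj:
  assumes S: "open S" "z \<in> S" and H: "H holomorphic_on S" and G: "G holomorphic_on S"
    and F: "\<And>z. z \<in> S \<Longrightarrow> F z = H z + \<mu> * cnj (G z)"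
  shows "((\<lambda>t. F (z + v * of_real t)) has_vector_derivative
           v * deriv H z + \<mu> * cnj (v * deriv G z)) (at 0)"
proof -
  define l where "l t = z + v * of_real t" for t :: real
  have l: "(l has_derivative (\<lambda>s. s *\<^sub>R v)) (at 0)"
    unfolding l_def[abs_def]
    by (auto intro!: derivative_eq_intros simp: fun_eq_iff scaleR_conv_of_real)
  have "((\<lambda>z. H z + \<mu> * cnj (G z)) has_derivative
      (\<lambda>d. deriv H z * d + \<mu> * cnj (deriv G z * d))) (at (l 0))"
    using has_derivative_holomorphic_plus_cnj[OF holomorphic_derivI[OF H S] holomorphic_derivI[OF G S]]
    by (simp add: l_def)
  from has_derivative_compose[OF l this]
  have "((\<lambda>t. H (l t) + \<mu> * cnj (G (l t))) has_vector_derivative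
           v * deriv H z + \<mu> * cnj (v * deriv G z)) (at 0)"
    by (simp add: has_vector_derivative_def algebra_simps)
  moreover have "open (l -` S)"
    unfolding l_def[abs_def] by (intro open_vimage S continuous_intros)
  ultimately have "((\<lambda>t. F (l t)) has_vector_derivative
           v * deriv H z + \<mu> * cnj (v * deriv G z)) (at 0)"
    by (rule has_vector_derivative_transform_within_open) (use S F in \<open>auto simp: l_def\<close>)
  then show ?thesis by (simp add: l_def)
qed

lemma dx_dy_holomorphic_plus_cnj:
  assumes "open S" "H holomorphic_on S" "G holomorphic_on S"
    and "\<And>z. z \<in> S \<Longrightarrow> F z = H z + \<mu> * cnj (G z)" and "z \<in> S"
  shows "dx F z = deriv H z + \<mu> * cnj (deriv G z)"
    and "dy F z = \<i> * deriv H z + \<mu> * cnj (\<i> * deriv G z)"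
  unfolding dx_def dy_def
  using has_vector_derivative_holomorphic_plus_cnj[OF assms(1,5,2,3,4), of 1]
    has_vector_derivative_holomorphic_plus_cnj[OF assms(1,5,2,3,4), of \<i>]
  by (auto intro!: vector_derivative_at)

lemma differentiable_on_holomorphic_plus_cnj:
  assumes S: "open S" and H: "H holomorphic_on S" and G: "G holomorphic_on S"
    and F: "\<And>z. z \<in> S \<Longrightarrow> F z = H z + \<mu> * cnj (G z)"
  shows "F differentiable_on S"
  unfolding differentiable_on_def
proof
  fix z assume z: "z \<in> S"
  have "(F has_derivative (\<lambda>d. deriv H z * d + \<mu> * cnj (deriv G z * d))) (at z)"
    using has_derivative_holomorphic_plus_cnj[OF holomorphic_derivI[OF H S z]
        holomorphic_derivI[OF G S z], of \<mu>]
    by (rule has_derivative_transform_within_open[OF _ S z]) (simp add: F)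
  then show "F differentiable at z within S"
    using differentiable_at_withinI differentiable_def by blast
qed

text \<open>
  By \<open>dx_dy_holomorphic_plus_cnj\<close>, functions of the form \<open>H + \<mu> cnj G\<close> on \<open>S\<close>
  are closed under both partial derivatives: \<open>dx\<close> sends the pair \<open>(H, G)\<close> to \<open>(H', G')\<close>, and \<open>dy\<close> sends it to
  \<open>(\<i>H', \<i>G')\<close>. Every regularity condition on the second partial derivatives therefore follows from
  the corresponding one for this class, and the Laplacian vanishes since \<open>\<i>\<^sup>2 = -1\<close>.
\<close>
lemma harmonic_on_holomorphic_plus_cnj:
  assumes S: "open S" and H: "H holomorphic_on S" and G: "G holomorphic_on S"
    and F: "\<And>z. z \<in> S \<Longrightarrow> F z = H z + \<mu> * cnj (G z)"
  shows "harmonic_on F S"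
proof -
  note dF = dx_dy_holomorphic_plus_cnj[OF S H G F]
  have H': "deriv H holomorphic_on S" "(\<lambda>z. \<i> * deriv H z) holomorphic_on S"
    and G': "deriv G holomorphic_on S" "(\<lambda>z. \<i> * deriv G z) holomorphic_on S"
    using H G S by (auto intro!: holomorphic_intros)
  note ddx = dx_dy_holomorphic_plus_cnj[OF S H'(1) G'(1) dF(1)]
  note ddy = dx_dy_holomorphic_plus_cnj[OF S H'(2) G'(2) dF(2)]
  have H'': "deriv (deriv H) holomorphic_on S" "deriv (\<lambda>z. \<i> * deriv H z) holomorphic_on S"
    and G'': "deriv (deriv G) holomorphic_on S" "deriv (\<lambda>z. \<i> * deriv G z) holomorphic_on S"
    using H' G' S by (auto intro!: holomorphic_deriv)
  have c: "continuous_on S (\<lambda>z. A z + \<mu> * cnj (B z))"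
    "continuous_on S (\<lambda>z. \<i> * A z + \<mu> * cnj (\<i> * B z))"
    if "A holomorphic_on S" "B holomorphic_on S" for A B
    using that[THEN holomorphic_on_imp_continuous_on] by (auto intro!: continuous_intros)
  show ?thesis
    unfolding harmonic_on_def
  proof (intro conjI ballI)
    show "F differentiable_on S"
      by (rule differentiable_on_holomorphic_plus_cnj[OF S H G F])
    show "dx F differentiable_on S"
      by (rule differentiable_on_holomorphic_plus_cnj[OF S H'(1) G'(1) dF(1)])
    show "dy F differentiable_on S"
      by (rule differentiable_on_holomorphic_plus_cnj[OF S H'(2) G'(2) dF(2)])
    show "continuous_on S (dx (dx F))"
      using c(1)[OF H''(1) G''(1)] by (rule continuous_on_eq) (simp add: ddx(1))
    show "continuous_on S (dy (dx F))"
      using c(2)[OF H''(1) G''(1)] by (rule continuous_on_eq) (simp add: ddx(2))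
    show "continuous_on S (dx (dy F))"
      using c(1)[OF H''(2) G''(2)] by (rule continuous_on_eq) (simp add: ddy(1))
    show "continuous_on S (dy (dy F))"
      using c(2)[OF H''(2) G''(2)] by (rule continuous_on_eq) (simp add: ddy(2))
    fix z assume z: "z \<in> S"
    have "deriv (\<lambda>z. \<i> * deriv H z) z = \<i> * deriv (deriv H) z"
      "deriv (\<lambda>z. \<i> * deriv G z) z = \<i> * deriv (deriv G) z"
      using H'(1) G'(1) S z by (auto intro!: deriv_cmult holomorphic_on_imp_differentiable_at)
    then show "dx (dx F) z + dy (dy F) z = 0"
      using z by (simp add: ddx ddy)
  qed (fact S)
qed

lemma wirtinger_holomorphic_plus_cnj:
  assumes "open S" "H holomorphic_on S" "G holomorphic_on S"
    and "\<And>z. z \<in> S \<Longrightarrow> F z = H z + \<mu> * cnj (G z)" and "z \<in> S"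
  shows "wirtinger F z = deriv H z" "wirtinger_bar F z = \<mu> * cnj (deriv G z)"
  by (simp_all add: wirtinger_def wirtinger_bar_def dx_dy_holomorphic_plus_cnj[OF assms]
      algebra_simps)

section \<open>Shears of close-to-convex functions\<close>

text \<open>
  At a zero of \<open>h'\<close> the quotient carries no information, because division by zero yields zero.
  As the zeros of \<open>h'\<close> are isolated, the bound extends there by continuity.
\<close>
lemma dilatation_bound_imp_deriv_bound:
  assumes S: "open S" "connected S" and h: "h holomorphic_on S" and g: "g holomorphic_on S"
    and nz: "\<exists>z\<in>S. deriv h z \<noteq> 0"
    and bound: "\<And>z. z \<in> S \<Longrightarrow> cmod (deriv g z / deriv h z) \<le> M"
    and z: "z \<in> S"
  shows "cmod (deriv g z) \<le> M * cmod (deriv h z)"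
proof (cases "deriv h z = 0")
  case False
  then show ?thesis using bound[OF z] by (simp add: norm_divide field_simps)
next
  case True
  have h': "deriv h holomorphic_on S" and g': "deriv g holomorphic_on S"
    using h g S by (auto intro!: holomorphic_deriv)
  obtain y where "y \<in> S" "deriv h y \<noteq> 0" using nz by auto
  then obtain r where r: "0 < r" "ball z r \<subseteq> S" "\<And>w. w \<in> ball z r - {z} \<Longrightarrow> deriv h w \<noteq> 0"
    using isolated_zeros[OF h' S z True] by metis
  have "\<forall>\<^sub>F w in at z. w \<in> ball z r - {z}"
    using r(1) by (intro eventually_at_in_open) auto
  then have ev: "\<forall>\<^sub>F w in at z. cmod (deriv g w) \<le> M * cmod (deriv h w)"
  proof eventually_elim
    case (elim w)
    then have "deriv h w \<noteq> 0" "w \<in> S" using r by auto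
    then show ?case using bound[of w] by (simp add: norm_divide field_simps)
  qed
  have "deriv g \<midarrow>z\<rightarrow> deriv g z" "deriv h \<midarrow>z\<rightarrow> deriv h z"
    using h' g' S z by (auto simp: isCont_def[symmetric] intro!: field_differentiable_imp_continuous_at holomorphic_on_imp_differentiable_at)
  then show ?thesis
    by (intro tendsto_le[OF trivial_limit_at _ _ ev] tendsto_intros)
qed

text \<open>
  The core of the theorem, for both parts at once: the map \<open>(h + \<mu> cnj g) \<circ> \<phi>\<inverse>\<close> on the convex
  domain \<open>\<phi>(\<D>)\<close> falls under \<open>directed_map_on_convex\<close>, with the constant \<open>k\<close> supplied by
  \<open>directed_affine_bound\<close>.
\<close>
lemma close_to_convex_shear:
  fixes \<mu> :: complex
  assumes \<alpha>: "0 \<le> \<alpha>" "\<alpha> < 1"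
    and h: "h holomorphic_on \<D>" and g: "g holomorphic_on \<D>"
    and ctc: "close_to_convex \<alpha> (\<lambda>z. h z - g z) \<or> close_to_convex \<alpha> (\<lambda>z. h z + g z)"
    and bound: "\<And>z. z \<in> \<D> \<Longrightarrow> cmod (deriv g z) \<le> M * cmod (deriv h z)"
    and M: "0 \<le> M" "M * (1 + cmod \<mu> + cos (\<alpha> * pi / 2)) < cos (\<alpha> * pi / 2)"
  shows "\<And>z. z \<in> \<D> \<Longrightarrow> deriv h z \<noteq> 0"
    and "inj_on (\<lambda>z. h z + \<mu> * cnj (g z)) \<D>"
    and "linearly_connected_domain
           ((1 + cmod \<mu> * M) / (cos (\<alpha> * pi / 2) - M * (1 + cmod \<mu> + cos (\<alpha> * pi / 2))))
           ((\<lambda>z. h z + \<mu> * cnj (g z)) ` \<D>)"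
proof -
  define c where "c = cos (\<alpha> * pi / 2)"
  define k where "k = (c - M * (1 + cmod \<mu> + c)) / (1 + cmod \<mu> * M)"
  have "0 < c"
    unfolding c_def using \<alpha> by (intro cos_gt_zero_pi) (auto simp: field_simps intro: order_less_le_trans[of _ 0])
  have pos: "0 < 1 + cmod \<mu> * M"
    using M(1) by (simp add: add_pos_nonneg)
  have k: "0 < k" "k * (1 + cmod \<mu> * M) = c - M * (1 + cmod \<mu> + c)"
    using M pos by (auto simp: k_def c_def)
  from ctc obtain F where F: "F = (\<lambda>z. h z + g z) \<or> F = (\<lambda>z. h z - g z)" "close_to_convex \<alpha> F"
    by auto
  from F(2) obtain \<phi> where Fi: "F holomorphic_on \<D>" "inj_on F \<D>"
    and \<phi>: "\<phi> holomorphic_on \<D>" "inj_on \<phi> \<D>" "convex (\<phi> ` \<D>)"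
    and Arg: "\<And>z. z \<in> \<D> \<Longrightarrow> \<bar>Arg (deriv F z / deriv \<phi> z)\<bar> \<le> \<alpha> * pi / 2"
    unfolding close_to_convex_def by blast
  obtain \<psi> where \<psi>: "\<psi> holomorphic_on \<phi> ` \<D>"
      "\<And>z. z \<in> \<D> \<Longrightarrow> deriv \<phi> z * deriv \<psi> (\<phi> z) = 1" "\<And>z. z \<in> \<D> \<Longrightarrow> \<psi> (\<phi> z) = z"
    using holomorphic_has_inverse[OF \<phi>(1) open_ball \<phi>(2)] by blast
  have \<phi>': "deriv \<phi> z \<noteq> 0" if "z \<in> \<D>" for z
    using holomorphic_injective_imp_regular[OF \<phi>(1) open_ball \<phi>(2) that] .
  have F': "deriv F z = deriv h z + deriv g z \<or> deriv F z = deriv h z - deriv g z" if "z \<in> \<D>" for z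
    using F(1) holomorphic_on_imp_differentiable_at[OF h open_ball that]
      holomorphic_on_imp_differentiable_at[OF g open_ball that] by auto
  show h': "deriv h z \<noteq> 0" if "z \<in> \<D>" for z
  proof
    \<comment> \<open>A zero of h' is a zero of g', hence a critical point of the univalent function F.\<close>
    assume "deriv h z = 0"
    then have "deriv F z = 0" using bound[OF that] F'[OF that] by auto
    then show False
      using holomorphic_injective_imp_regular[OF Fi(1) open_ball Fi(2) that] by simp
  qed
  let ?f = "\<lambda>z. h z + \<mu> * cnj (g z)"
  let ?T = "\<lambda>\<zeta>. ?f (\<psi> \<zeta>)"
  define a where "a \<zeta> = deriv h (\<psi> \<zeta>) / deriv \<phi> (\<psi> \<zeta>)" for \<zeta>
  define b where "b \<zeta> = deriv g (\<psi> \<zeta>) / deriv \<phi> (\<psi> \<zeta>)" for \<zeta>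
  have op: "open (\<phi> ` \<D>)" by (rule open_mapping_thm3[OF \<phi>(1) open_ball \<phi>(2)])
  have der: "(?T has_derivative (\<lambda>d. a \<zeta> * d + \<mu> * cnj (b \<zeta> * d))) (at \<zeta>)" if "\<zeta> \<in> \<phi> ` \<D>" for \<zeta>
  proof (rule has_derivative_holomorphic_plus_cnj)
    from that obtain z where z: "z \<in> \<D>" "\<zeta> = \<phi> z" by auto
    have d: "(\<psi> has_field_derivative 1 / deriv \<phi> z) (at \<zeta>)"
    proof -
      have "deriv \<psi> \<zeta> = 1 / deriv \<phi> z"
        using \<psi>(2)[OF z(1)] \<phi>'[OF z(1)] z(2) by (simp add: field_simps)
      then show ?thesis using holomorphic_derivI[OF \<psi>(1) op that] by simp
    qed
    show "((\<lambda>\<zeta>. h (\<psi> \<zeta>)) has_field_derivative a \<zeta>) (at \<zeta>)"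
      using DERIV_chain2[OF _ d, of h] holomorphic_derivI[OF h open_ball z(1)] \<psi>(3)[OF z(1)] z(2)
      by (simp add: a_def)
    show "((\<lambda>\<zeta>. g (\<psi> \<zeta>)) has_field_derivative b \<zeta>) (at \<zeta>)"
      using DERIV_chain2[OF _ d, of g] holomorphic_derivI[OF g open_ball z(1)] \<psi>(3)[OF z(1)] z(2)
      by (simp add: b_def)
  qed
  have ab: "a \<zeta> \<noteq> 0" "cmod (b \<zeta>) \<le> M * cmod (a \<zeta>)"
    "c * cmod (deriv F (\<psi> \<zeta>) / deriv \<phi> (\<psi> \<zeta>)) \<le> Re (deriv F (\<psi> \<zeta>) / deriv \<phi> (\<psi> \<zeta>))"
    "deriv F (\<psi> \<zeta>) / deriv \<phi> (\<psi> \<zeta>) = a \<zeta> + b \<zeta> \<or> deriv F (\<psi> \<zeta>) / deriv \<phi> (\<psi> \<zeta>) = a \<zeta> - b \<zeta>"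
    if "\<zeta> \<in> \<phi> ` \<D>" for \<zeta>
  proof -
    have z: "\<psi> \<zeta> \<in> \<D>" using that \<psi>(3) by auto
    show "a \<zeta> \<noteq> 0" using h'[OF z] \<phi>'[OF z] by (simp add: a_def)
    show "cmod (b \<zeta>) \<le> M * cmod (a \<zeta>)"
      using bound[OF z] by (simp add: a_def b_def norm_divide divide_right_mono)
    have "\<alpha> * pi / 2 \<le> pi" using \<alpha> mult_right_mono[of \<alpha> 1 pi] pi_gt_zero by linarith
    then show "c * cmod (deriv F (\<psi> \<zeta>) / deriv \<phi> (\<psi> \<zeta>)) \<le> Re (deriv F (\<psi> \<zeta>) / deriv \<phi> (\<psi> \<zeta>))"
      unfolding c_def by (rule cos_mult_cmod_le_Re[OF Arg[OF z]])
    show "deriv F (\<psi> \<zeta>) / deriv \<phi> (\<psi> \<zeta>) = a \<zeta> + b \<zeta> \<or>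
        deriv F (\<psi> \<zeta>) / deriv \<phi> (\<psi> \<zeta>) = a \<zeta> - b \<zeta>"
      using F'[OF z] by (auto simp: a_def b_def add_divide_distrib diff_divide_distrib)
  qed
  have dir: "k * (cmod (a \<zeta> * d + \<mu> * cnj (b \<zeta> * d)) * cmod d) \<le> (a \<zeta> * d + \<mu> * cnj (b \<zeta> * d)) \<bullet> d"
    if "\<zeta> \<in> \<phi> ` \<D>" for \<zeta> d
    by (rule directed_affine_bound[OF ab(2,3,4)[OF that] _ M(1) k(2)])
      (use \<open>0 < c\<close> k in auto)
  have nz: "a \<zeta> * d + \<mu> * cnj (b \<zeta> * d) \<noteq> 0" if "\<zeta> \<in> \<phi> ` \<D>" "d \<noteq> 0" for \<zeta> d
  proof
    \<comment> \<open>The linear part dominates the anti-linear one because the bound on M forces \<bar>\<mu>\<bar> M < 1.\<close>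
    assume "a \<zeta> * d + \<mu> * cnj (b \<zeta> * d) = 0"
    then have "cmod (a \<zeta> * d) = cmod (\<mu> * cnj (b \<zeta> * d))"
      by (metis add_eq_0_iff norm_minus_cancel)
    then have "cmod (a \<zeta>) = cmod \<mu> * cmod (b \<zeta>)" using that by (simp add: norm_mult)
    also have "\<dots> \<le> cmod \<mu> * (M * cmod (a \<zeta>))"
      using ab(2)[OF that(1)] by (intro mult_left_mono) auto
    finally have "1 \<le> cmod \<mu> * M" using ab(1)[OF that(1)] by simp
    moreover have "M * (1 + cmod \<mu> + c) < c" "c \<le> 1" "0 \<le> M * c" using M \<open>0 < c\<close> by (auto simp: c_def)
    ultimately show False using M(1) by (simp add: algebra_simps)
  qed
  have ne: "\<phi> ` \<D> \<noteq> {}" by simp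
  have T: "inj_on ?T (\<phi> ` \<D>)" "linearly_connected_domain (1 / k) (?T ` \<phi> ` \<D>)"
    using directed_map_on_convex[where T = ?T
        and T' = "\<lambda>\<zeta> d. a \<zeta> * d + \<mu> * cnj (b \<zeta> * d)", OF op \<phi>(3) ne k(1) der nz dir]
    by blast+
  have img: "?T ` \<phi> ` \<D> = ?f ` \<D>" using \<psi>(3) by (auto simp: image_image)
  show "inj_on ?f \<D>"
  proof (rule inj_onI)
    fix z w assume zw: "z \<in> \<D>" "w \<in> \<D>" "?f z = ?f w"
    then have "\<phi> z = \<phi> w"
      using inj_onD[OF T(1), of "\<phi> z" "\<phi> w"] \<psi>(3) by simp
    then show "z = w" using \<phi>(2) zw(1,2) by (auto dest: inj_onD)
  qed
  show "linearly_connected_domain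
      ((1 + cmod \<mu> * M) / (cos (\<alpha> * pi / 2) - M * (1 + cmod \<mu> + cos (\<alpha> * pi / 2)))) (?f ` \<D>)"
    using T(2) unfolding img by (simp add: k_def c_def)
qed

section \<open>Quasiconformality and the theorem\<close>

lemma quasiconformal_harmonic_holomorphic_plus_cnj:
  assumes h: "h holomorphic_on \<D>" and g: "g holomorphic_on \<D>" and \<mu>: "cmod \<mu> = 1"
    and h': "\<And>z. z \<in> \<D> \<Longrightarrow> deriv h z \<noteq> 0"
    and bound: "\<And>z. z \<in> \<D> \<Longrightarrow> cmod (deriv g z) \<le> M * cmod (deriv h z)" and "M < 1"
    and inj: "inj_on (\<lambda>z. h z + \<mu> * cnj (g z)) \<D>"
  shows "quasiconformal_harmonic ((1 + M) / (1 - M)) (\<lambda>z. h z + \<mu> * cnj (g z))"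
proof -
  let ?f = "\<lambda>z. h z + \<mu> * cnj (g z)"
  have w: "cmod (wirtinger ?f z) = cmod (deriv h z)" "cmod (wirtinger_bar ?f z) = cmod (deriv g z)"
    if "z \<in> \<D>" for z
    using wirtinger_holomorphic_plus_cnj[OF open_ball h g refl that] \<mu> by (auto simp: norm_mult)
  have less: "cmod (deriv g z) < cmod (deriv h z)" if "z \<in> \<D>" for z
  proof -
    have "M * cmod (deriv h z) < 1 * cmod (deriv h z)"
      using h'[OF that] \<open>M < 1\<close> by (intro mult_strict_right_mono) auto
    with bound[OF that] show ?thesis by linarith
  qed
  have "max_stretch ?f z \<le> (1 + M) / (1 - M) * min_stretch ?f z" if "z \<in> \<D>" for z
    using bound[OF that] less[OF that] \<open>M < 1\<close> w[OF that]
    by (simp add: max_stretch_def min_stretch_def field_simps)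
  then show ?thesis
    unfolding quasiconformal_harmonic_def sense_preserving_on_def
    using harmonic_on_holomorphic_plus_cnj[OF open_ball h g refl] inj less
    by (auto simp: w power_strict_mono)
qed

theorem theorem4:
  fixes \<alpha> :: real and f h g \<omega> :: "complex \<Rightarrow> complex"
  assumes "0 \<le> \<alpha>" and "\<alpha> < 1"
    and "h holomorphic_on \<D>" and "g holomorphic_on \<D>"
    and "harmonic_on f \<D>"
    and "\<And>z. z \<in> \<D> \<Longrightarrow> f z = h z + cnj (g z)"
    and "\<exists>z\<in>\<D>. deriv h z \<noteq> 0"  (* the quotient g'/h' makes sense *)
    and "\<And>z. z \<in> \<D> \<Longrightarrow> \<omega> z = deriv g z / deriv h z"
  shows
    "(\<forall>M1::real.
        (close_to_convex \<alpha> (\<lambda>z. h z - g z) \<or> close_to_convex \<alpha> (\<lambda>z. h z + g z)) \<longrightarrow>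
        (\<forall>z\<in>\<D>. cmod (\<omega> z) \<le> M1) \<longrightarrow>
        M1 < cos (\<alpha> * pi / 2) / (1 + cos (\<alpha> * pi / 2)) \<longrightarrow>
        inj_on h \<D> \<and>
        linearly_connected_domain
          (1 / (cos (\<alpha> * pi / 2) - M1 * (1 + cos (\<alpha> * pi / 2)))) (h ` \<D>)) \<and>
     (\<forall>M3::real.
        (close_to_convex \<alpha> (\<lambda>z. h z - g z) \<or> close_to_convex \<alpha> (\<lambda>z. h z + g z)) \<longrightarrow>
        (\<forall>z\<in>\<D>. cmod (\<omega> z) \<le> M3) \<longrightarrow>
        M3 < cos (\<alpha> * pi / 2) / (2 + cos (\<alpha> * pi / 2)) \<longrightarrow>
        (\<forall>\<theta>\<in>{0..<2 * pi}.
           quasiconformal_harmonic ((1 + M3) / (1 - M3))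
             (\<lambda>z. h z + exp (\<i> * of_real \<theta>) * cnj (g z)) \<and>
           linearly_connected_domain
             ((1 + M3) / (cos (\<alpha> * pi / 2) - M3 * (2 + cos (\<alpha> * pi / 2))))
             ((\<lambda>z. h z + exp (\<i> * of_real \<theta>) * cnj (g z)) ` \<D>)))"
proof (intro conjI allI impI ballI)
  let ?c = "cos (\<alpha> * pi / 2)"
  note h = assms(3) and g = assms(4)
  have "0 < ?c"
    using assms(1,2) by (intro cos_gt_zero_pi) (auto simp: field_simps intro: order_less_le_trans[of _ 0])
  have bound: "cmod (deriv g z) \<le> M * cmod (deriv h z)" if "\<forall>z\<in>\<D>. cmod (\<omega> z) \<le> M" "z \<in> \<D>" for M z
    by (rule dilatation_bound_imp_deriv_bound[OF open_ball connected_ball h g assms(7) _ that(2)])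
      (use assms(8) that(1) in auto)
  have nonneg: "0 \<le> M" if "\<forall>z\<in>\<D>. cmod (\<omega> z) \<le> M" for M
    using bspec[OF that, of 0] norm_ge_zero[of "\<omega> 0"] by (simp del: norm_ge_zero)
  {
    fix M1 :: real
    assume ctc: "close_to_convex \<alpha> (\<lambda>z. h z - g z) \<or> close_to_convex \<alpha> (\<lambda>z. h z + g z)"
      and M1: "\<forall>z\<in>\<D>. cmod (\<omega> z) \<le> M1" "M1 < ?c / (1 + ?c)"
    \<comment> \<open>The analytic part h alone is the shear with coefficient 0.\<close>
    have less: "M1 * (1 + cmod 0 + ?c) < ?c"
      using M1(2) \<open>0 < ?c\<close> by (simp add: field_simps)
    note shear = close_to_convex_shear[OF assms(1,2) h g ctc bound[OF M1(1)] nonneg[OF M1(1)] less]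
    show "inj_on h \<D>" using shear(2) by simp
    show "linearly_connected_domain (1 / (?c - M1 * (1 + ?c))) (h ` \<D>)"
      using shear(3) by simp
  next
    fix M3 \<theta> :: real
    assume ctc: "close_to_convex \<alpha> (\<lambda>z. h z - g z) \<or> close_to_convex \<alpha> (\<lambda>z. h z + g z)"
      and M3: "\<forall>z\<in>\<D>. cmod (\<omega> z) \<le> M3" "M3 < ?c / (2 + ?c)"
    define \<mu> where "\<mu> = exp (\<i> * of_real \<theta>)"
    have \<mu>: "cmod \<mu> = 1" by (simp add: \<mu>_def)
    have less: "M3 * (1 + cmod \<mu> + ?c) < ?c"
      using M3(2) \<open>0 < ?c\<close> by (simp add: \<mu> field_simps)
    have "?c / (2 + ?c) < 1" using \<open>0 < ?c\<close> by simp
    then have "M3 < 1" using M3(2) by linarith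
    note shear = close_to_convex_shear[OF assms(1,2) h g ctc bound[OF M3(1)] nonneg[OF M3(1)] less]
    show "quasiconformal_harmonic ((1 + M3) / (1 - M3)) (\<lambda>z. h z + exp (\<i> * of_real \<theta>) * cnj (g z))"
      using quasiconformal_harmonic_holomorphic_plus_cnj
        [OF h g \<mu> shear(1) bound[OF M3(1)] \<open>M3 < 1\<close> shear(2)]
      by (simp add: \<mu>_def)
    show "linearly_connected_domain ((1 + M3) / (?c - M3 * (2 + ?c)))
        ((\<lambda>z. h z + exp (\<i> * of_real \<theta>) * cnj (g z)) ` \<D>)"
      using shear(3) unfolding \<mu> by (simp add: \<mu>_def)
  }
qed

end
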